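(* Let $n,t \geq 1$ and $p \in (0,1/2)$. Then the maximum Lebesgue measure of a measurable set $\mathcal{F}\subseteq\mathbb{T}^n$ which is $t$-agreeing up to $p$ equals $w(n,t,p)$; that is, $w(\mathbb{T}^n,t,p)=w(n,t,p)$.
   Context: $\mathbb{T}$ is the circle of unit circumference ($[0,1]$ with endpoints identified), with its arc-length distance and Lebesgue measure; $\mathbb{T}^n$ carries the product measure $\mu$. A continuous family on $n$ points is a measurable $\mathcal{F}\subseteq\mathbb{T}^n$; it is $t$-agreeing up to $p$ if any $x,y\in\mathcal{F}$ have $t$ distinct coordinates $i_1,\dots,i_t$ at which the distance between $x_{i_j}$ and $y_{i_j}$ is less than $p$. $w(\mathbb{T}^n,t,p)$ is the maximum measure of such a family. For a family of subsets of $[n]$, $t$-intersecting means any two members share at least $t$ elements, $\mu_p(A)=p^{|A|}(1-p)^{n-|A|}$, and $w(n,t,p)$ is the maximum $\mu_p$-measure of a $t$-intersecting family of subsets of $[n]$. *)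

theory Defs
  imports "HOL-Analysis.Analysis"
begin

text \<open>
  The circle of unit circumference is represented by the fundamental domain \<open>{0..<1}\<close>, i.e.
  \<open>[0,1]\<close> with the endpoint \<open>1\<close> identified with \<open>0\<close>.  The arc-length distance is
  the length of the shorter of the two arcs joining the points.
\<close>

definition circle :: "real measure" where
  "circle = restrict_space lborel {0..<1}"

definition circle_dist :: "real \<Rightarrow> real \<Rightarrow> real" where
  "circle_dist x y = min \<bar>x - y\<bar> (1 - \<bar>x - y\<bar>)"

text \<open>Completing the product of the Borel measures makes the measurable sets exactly the
  Lebesgue measurable ones.\<close>

definition torus :: "nat \<Rightarrow> (nat \<Rightarrow> real) measure" where
  "torus n = completion (PiM {1..n} (\<lambda>_. circle))"

text \<open>In both notions of family below, the two members need not be distinct.\<close>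

definition agreeing_up_to :: "nat \<Rightarrow> nat \<Rightarrow> real \<Rightarrow> (nat \<Rightarrow> real) set \<Rightarrow> bool" where
  "agreeing_up_to n t p F \<longleftrightarrow>
     (\<forall>x\<in>F. \<forall>y\<in>F. \<exists>I\<subseteq>{1..n}. card I = t \<and> (\<forall>i\<in>I. circle_dist (x i) (y i) < p))"

definition t_intersecting :: "nat \<Rightarrow> nat set set \<Rightarrow> bool" where
  "t_intersecting t F \<longleftrightarrow> (\<forall>A\<in>F. \<forall>B\<in>F. t \<le> card (A \<inter> B))"

definition mu_p :: "nat \<Rightarrow> real \<Rightarrow> nat set set \<Rightarrow> real" where
  "mu_p n p F = (\<Sum>A\<in>F. p ^ card A * (1 - p) ^ (n - card A))"

definition w :: "nat \<Rightarrow> nat \<Rightarrow> real \<Rightarrow> real" where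
  "w n t p = Max {mu_p n p F | F. F \<subseteq> Pow {1..n} \<and> t_intersecting t F}"

text \<open>The set of measures here is infinite, so \<open>Max\<close> is not applicable; \<open>GREATEST\<close>
  is meaningful only where the maximum is attained.\<close>

definition w_torus :: "nat \<Rightarrow> nat \<Rightarrow> real \<Rightarrow> real" where
  "w_torus n t p =
     (GREATEST m. \<exists>F\<in>sets (torus n). agreeing_up_to n t p F \<and> m = measure (torus n) F)"

end

theory Submission
  imports Defs
begin

text \<open>
  The arc \<open>{0..<p}\<close> plays the role of the value \<open>1\<close>, which gives the lower bound: pull back an
  optimal family of subsets along \<open>x \<mapsto> {i. x i < p}\<close>.  For the upper bound, the agreement relation
  is replaced one coordinate at a time by ``both values lie in \<open>{0..<p}\<close>''.  At coordinate \<open>k\<close> let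
  \<open>v y\<close> be the measure of the fibre over \<open>y\<close>.  If \<open>y\<close> and \<open>y'\<close> agree on only \<open>t - 1\<close> of the other
  coordinates, the two fibres are pairwise at distance less than \<open>p\<close>, which forces
  \<open>v y + v y' \<le> 2 * p\<close> when both are nonempty.  Hence for each \<open>a \<in> {0..p}\<close> the family with fibre
  \<open>{0..<1}\<close> where \<open>v y > p + a\<close>, fibre \<open>{0..<p}\<close> where \<open>p - a < v y \<le> p + a\<close>, and empty fibre
  elsewhere is agreeing for the new relation; averaged over \<open>a\<close>, its measure is at least that of
  the original family.
\<close>

section \<open>Measures of two sets on the circle whose points are pairwise close\<close>

definition unwrap :: "real \<Rightarrow> real set \<Rightarrow> real set" where
  "unwrap c A = {x. c \<le> x \<and> x < c + 1 \<and> frac x \<in> A}"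

text \<open>The window from \<open>c\<close> to \<open>c + 1\<close> meets two copies of the
  fundamental domain. Cutting \<open>A\<close> at \<open>frac c\<close>, the upper piece is
  translated by the floor of \<open>c\<close> and the lower piece by one more, and translations
  preserve measure.\<close>

lemma measure_unwrap:
  assumes "A \<in> sets borel" "A \<subseteq> {0..<1}"
  shows "unwrap c A \<in> lmeasurable" "measure lebesgue (unwrap c A) = measure lborel A"
proof -
  define k where "k = real_of_int \<lfloor>c\<rfloor>"
  define d where "d = frac c"
  have c: "c = k + d" "0 \<le> d" "d < 1" by (auto simp: k_def d_def frac_def) linarith
  let ?U = "(+) k ` (A \<inter> {d..<1})" and ?V = "(+) (k+1) ` (A \<inter> {0..<d})"
  have eq: "unwrap c A = ?U \<union> ?V"
  proof (rule set_eqI)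
    fix x
    have fr: "frac (k + y) = y" "frac (k + 1 + y) = y" if "0 \<le> y" "y < 1" for y
      using that by (auto simp: k_def frac_unique_iff)
    show "x \<in> unwrap c A \<longleftrightarrow> x \<in> ?U \<union> ?V"
    proof
      assume x: "x \<in> unwrap c A"
      show "x \<in> ?U \<union> ?V"
      proof (cases "x < k + 1")
        case True
        then have "frac x = x - k" using fr(1)[of "x - k"] x c by (auto simp: unwrap_def)
        then have "x = k + frac x" "frac x \<in> A \<inter> {d..<1}" using x c True by (auto simp: unwrap_def)
        then show ?thesis by blast
      next
        case False
        then have "frac x = x - (k + 1)" using fr(2)[of "x - (k+1)"] x c by (auto simp: unwrap_def)
        then have "x = (k + 1) + frac x" "frac x \<in> A \<inter> {0..<d}" using x c False by (auto simp: unwrap_def)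
        then show ?thesis by blast
      qed
    next
      assume "x \<in> ?U \<union> ?V"
      then show "x \<in> unwrap c A" using fr c assms(2) by (auto simp: unwrap_def)
    qed
  qed
  have "bounded (A \<inter> {d..<1})" "bounded (A \<inter> {0..<d})"
    using assms(2) by (meson bounded_Ico bounded_subset inf_le1 order_trans)+
  then have m: "A \<inter> {d..<1} \<in> lmeasurable" "A \<inter> {0..<d} \<in> lmeasurable"
    using assms(1) by (auto intro!: bounded_set_imp_lmeasurable)
  have mt: "?U \<in> lmeasurable" "?V \<in> lmeasurable"
    using m by (auto intro: measurable_translation)
  show "unwrap c A \<in> lmeasurable" unfolding eq using mt by auto
  have "?U \<inter> ?V = {}" using c by auto
  then have "measure lebesgue (unwrap c A) = measure lebesgue ?U + measure lebesgue ?V"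
    unfolding eq using mt by (intro measure_Un_AE) auto
  also have "\<dots> = measure lebesgue (A \<inter> {d..<1}) + measure lebesgue (A \<inter> {0..<d})"
    by (simp only: measure_translation)
  also have "\<dots> = measure lebesgue ((A \<inter> {d..<1}) \<union> (A \<inter> {0..<d}))"
    using m by (intro measure_Un_AE[symmetric]) auto
  also have "(A \<inter> {d..<1}) \<union> (A \<inter> {0..<d}) = A" using assms(2) c by fastforce
  finally show "measure lebesgue (unwrap c A) = measure lborel A" using assms(1) by (simp add: measure_completion)
qed

text \<open>Lifts closeness from the circle to the line. The candidates for \<open>k\<close> are the
  difference of the two floors and its two neighbours, the latter covering the arc through the glued
  endpoint.\<close>

lemma circle_dist_fracD:
  assumes "circle_dist (frac x) (frac y) < p"
  obtains k :: int where "\<bar>x - y - k\<bar> < p"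
proof -
  define m where "m = \<lfloor>x\<rfloor> - \<lfloor>y\<rfloor>"
  define u where "u = frac x - frac y"
  have "x - y = real_of_int m + u" by (simp add: frac_def m_def u_def)
  then have *: "x - y - real_of_int m = u" "x - y - real_of_int (m - 1) = u + 1"
    "x - y - real_of_int (m + 1) = u - 1" by simp_all
  have "\<bar>u\<bar> < 1"
    unfolding u_def using frac_ge_0[of x] frac_ge_0[of y] frac_lt_1[of x] frac_lt_1[of y] by arith
  moreover have "\<bar>u\<bar> < p \<or> 1 - \<bar>u\<bar> < p"
    using assms by (auto simp: circle_dist_def u_def)
  ultimately have "\<bar>u\<bar> < p \<or> \<bar>u + 1\<bar> < p \<or> \<bar>u - 1\<bar> < p"
    by (cases "0 \<le> u") auto
  then show ?thesis using that by (metis *)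
qed

text \<open>
  Rotating \<open>A\<close> by \<open>1/2\<close> turns ``closer than \<open>p\<close>'' into ``farther apart than \<open>q = 1/2 - p\<close>'', so the
  rotated set lies between two disjoint gaps of length \<open>q\<close> that avoid \<open>B\<close>.  The circle is cut
  open at a point of \<open>B\<close>.
\<close>

lemma measure_circle_close_le:
  assumes A: "A \<in> sets borel" "A \<subseteq> {0..<1}" "A \<noteq> {}"
    and B: "B \<in> sets borel" "B \<subseteq> {0..<1}" "B \<noteq> {}"
    and p: "0 < p" "p < 1/2"
    and close: "\<And>a b. a \<in> A \<Longrightarrow> b \<in> B \<Longrightarrow> circle_dist a b < p"
  shows "measure lborel A + measure lborel B \<le> 2 * p"
proof -
  obtain b where b: "b \<in> B" using B by auto
  then have b01: "0 \<le> b" "b < 1" using B by auto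
  define q where "q = 1/2 - p"
  have q: "0 < q" using p by (simp add: q_def)
  \<comment> \<open>The window starts at \<open>b - 1/2\<close> so that after the shift by
    \<open>1/2\<close> both \<open>A'\<close> and \<open>B'\<close> lie between \<open>b\<close> and
    \<open>b + 1\<close>.\<close>
  define A' where "A' = (+) (1/2) ` unwrap (b - 1/2) A"
  define B' where "B' = unwrap b B"
  have A'iff: "x \<in> A' \<longleftrightarrow> b \<le> x \<and> x < b + 1 \<and> frac (x - 1/2) \<in> A" for x
    by (auto simp: A'_def unwrap_def image_iff intro!: exI[of _ "x - 1/2"])
  have "frac b = b" using b01 by (simp add: frac_eq)
  then have bB: "b \<in> B'" using b by (simp add: B'_def unwrap_def)
  have sep: "q < \<bar>x - y\<bar> \<and> \<bar>x - y\<bar> < 1 - q" if "x \<in> A'" "y \<in> B'" for x y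
  proof -
    have xy: "\<bar>x - y\<bar> < 1" using that by (auto simp: A'iff B'_def unwrap_def)
    have "circle_dist (frac (x - 1/2)) (frac y) < p"
      using that close by (auto simp: A'iff B'_def unwrap_def)
    then obtain k :: int where k: "\<bar>x - 1/2 - y - k\<bar> < p"
      by (rule circle_dist_fracD)
    \<comment> \<open>Only \<open>k = 0\<close> and \<open>k = -1\<close> survive, so
      \<open>x - y\<close> is within \<open>p\<close> of \<open>1/2\<close> or of
      \<open>-1/2\<close>; this is the claimed separation, as
      \<open>1 - q = 1/2 + p\<close>.\<close>
    then have "\<bar>real_of_int k + 1/2\<bar> < 3/2" using xy p by linarith
    then have "k = 0 \<or> k = -1" by linarith
    then show ?thesis using k xy by (auto simp: q_def)
  qed
  have mA: "A' \<in> lmeasurable" "measure lebesgue A' = measure lborel A"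
    unfolding A'_def using measure_unwrap[OF A(1,2)] by (simp_all add: measurable_translation measure_translation)
  have mB: "B' \<in> lmeasurable" "measure lebesgue B' = measure lborel B"
    unfolding B'_def using measure_unwrap[OF B(1,2)] by simp_all
  \<comment> \<open>Since the cut point \<open>b\<close> itself belongs to \<open>B'\<close>, the
    set \<open>A'\<close> keeps distance \<open>q\<close> from both ends of the window, which leaves
    room for the two gaps.\<close>
  have A'sub: "b + q < x \<and> x < b + 1 - q" if "x \<in> A'" for x
    using sep[OF that bB] that by (auto simp: A'iff)
  have A'le: "b + q \<le> x" "x \<le> b + 1 - q" if "x \<in> A'" for x
    using A'sub[OF that] by simp_all
  have bdd: "bdd_below A'" "bdd_above A'"
    by (rule bdd_belowI[OF A'le(1)], assumption) (rule bdd_aboveI[OF A'le(2)], assumption)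
  show ?thesis
  proof (cases "A' = {}")
    \<comment> \<open>This case is impossible: \<open>x\<close> is the representative in the window
      of a point of \<open>A\<close>.\<close>
    case True
    obtain a where a: "a \<in> A" using A by auto
    then have a01: "0 \<le> a" "a < 1" using A by auto
    define x where "x = (b - 1/2) + frac (a - (b - 1/2))"
    have "x - a = of_int (- \<lfloor>a - (b - 1/2)\<rfloor>)" by (simp add: x_def frac_def)
    then have "frac x = a" using a01 by (simp only: frac_unique_iff Ints_of_int)
    then have "x \<in> unwrap (b - 1/2) A" using a frac_ge_0[of "a - (b - 1/2)"] frac_lt_1[of "a - (b - 1/2)"]
      by (auto simp: unwrap_def x_def)
    then show ?thesis using True by (auto simp: A'_def)
  next
    case False
    \<comment> \<open>The gaps just below and just above \<open>A'\<close>. Points of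
      \<open>A'\<close> arbitrarily near its infimum and supremum exclude \<open>B'\<close> from
      them. Four disjoint sets then fit into length \<open>1\<close>, so the two measures sum to at
      most \<open>1 - 2 * q = 2 * p\<close>.\<close>
    let ?G = "{Inf A' - q<..<Inf A'}" and ?H = "{Sup A'<..<Sup A' + q}"
    have inf: "b + q \<le> Inf A'" "Sup A' \<le> b + 1 - q" "Inf A' \<le> Sup A'"
      using cInf_greatest[OF False A'le(1)] cSup_least[OF False A'le(2)] cInf_le_cSup[OF False bdd(2,1)]
      by simp_all
    have inA: "Inf A' \<le> x" "x \<le> Sup A'" if "x \<in> A'" for x
      using that bdd by (auto intro: cInf_lower cSup_upper)
    have G: "x \<notin> B'" if "x \<in> ?G" for x
    proof
      assume "x \<in> B'"
      have "Inf A' < x + q" using that by auto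
      then obtain a where "a \<in> A'" "a < x + q" using cInf_lessD[OF False] by auto
      then show False using sep[of a x] inA[of a] that \<open>x \<in> B'\<close> by auto
    qed
    have H: "x \<notin> B'" if "x \<in> ?H" for x
    proof
      assume "x \<in> B'"
      have "x - q < Sup A'" using that by auto
      then obtain a where "a \<in> A'" "x - q < a" using less_cSupD[OF False] by auto
      then show False using sep[of a x] inA[of a] that \<open>x \<in> B'\<close> by auto
    qed
    have AB: "x \<notin> B'" if "x \<in> A'" for x using sep[OF that, of x] q by auto
    have disj: "x \<notin> A' \<union> B' \<or> x \<notin> ?G \<union> ?H" for x
      using G[of x] H[of x] inA[of x] by fastforce
    have "measure lebesgue (A' \<union> B') = measure lebesgue A' + measure lebesgue B'"
      using mA mB AB by (intro measure_Un_AE) auto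
    moreover have "measure lebesgue (?G \<union> ?H) = measure lebesgue ?G + measure lebesgue ?H"
      using inf by (intro measure_Un_AE) auto
    moreover have "measure lebesgue ((A' \<union> B') \<union> (?G \<union> ?H)) = measure lebesgue (A' \<union> B') + measure lebesgue (?G \<union> ?H)"
      using mA mB disj by (intro measure_Un_AE fmeasurable.Un) auto
    moreover have "measure lebesgue ((A' \<union> B') \<union> (?G \<union> ?H)) \<le> measure lebesgue {b..b+1}"
    proof (rule measure_mono_fmeasurable)
      show "A' \<union> B' \<union> (?G \<union> ?H) \<subseteq> {b..b + 1}" using inf by (auto simp: A'iff B'_def unwrap_def)
    qed (use mA mB in auto)
    ultimately show ?thesis using mA mB q by (simp add: q_def)
  qed
qed

section \<open>The circle as a measure space, and the relations interpolating between the two kinds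
  of agreement\<close>

lemma space_circle [simp]: "space circle = {0..<1}"
  by (simp add: circle_def)

lemma sets_circle: "A \<in> sets circle \<longleftrightarrow> A \<in> sets borel \<and> A \<subseteq> {0..<1}"
  by (auto simp: circle_def sets_restrict_space_iff)

lemma emeasure_circle: "A \<subseteq> {0..<1} \<Longrightarrow> emeasure circle A = emeasure lborel A"
  by (simp add: circle_def emeasure_restrict_space)

lemma measure_circle: "A \<subseteq> {0..<1} \<Longrightarrow> measure circle A = measure lborel A"
  by (simp add: measure_def emeasure_circle)

lemma finite_measure_circle: "finite_measure circle"
  by (rule finite_measureI) (simp add: emeasure_circle)

lemma product_sigma_finite_circle: "product_sigma_finite (\<lambda>_. circle)"
  using finite_measure_circle by (auto simp: product_sigma_finite_def finite_measure_def)

lemma measurable_circle_borel [measurable_dest]: "f \<in> measurable M circle \<Longrightarrow> f \<in> borel_measurable M"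
  unfolding circle_def by (simp add: measurable_restrict_space2_iff)

text \<open>\<open>J\<close> collects the coordinates whose agreement relation has already been replaced.\<close>

definition mixed_close :: "nat set \<Rightarrow> real \<Rightarrow> nat \<Rightarrow> real \<Rightarrow> real \<Rightarrow> bool" where
  "mixed_close J p i a b \<longleftrightarrow> (if i \<in> J then a < p \<and> b < p else circle_dist a b < p)"

definition mixed_agreeing :: "nat \<Rightarrow> nat \<Rightarrow> real \<Rightarrow> nat set \<Rightarrow> (nat \<Rightarrow> real) set \<Rightarrow> bool" where
  "mixed_agreeing n t p J F \<longleftrightarrow> (\<forall>x\<in>F. \<forall>y\<in>F. t \<le> card {i\<in>{1..n}. mixed_close J p i (x i) (y i)})"

lemma agreeing_imp_mixed: "agreeing_up_to n t p F \<Longrightarrow> mixed_agreeing n t p {} F"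
  unfolding agreeing_up_to_def mixed_agreeing_def mixed_close_def
proof (intro ballI)
  fix x y assume *: "\<forall>x\<in>F. \<forall>y\<in>F. \<exists>I\<subseteq>{1..n}. card I = t \<and> (\<forall>i\<in>I. circle_dist (x i) (y i) < p)" "x \<in> F" "y \<in> F"
  then obtain I where "I \<subseteq> {1..n}" "card I = t" "\<forall>i\<in>I. circle_dist (x i) (y i) < p" by blast
  then show "t \<le> card {i \<in> {1..n}. if i \<in> {} then x i < p \<and> y i < p else circle_dist (x i) (y i) < p}"
    by (auto intro!: card_mono)
qed

section \<open>The discrete extremal value and pullbacks of set families to the torus\<close>

lemma finite_mu_p_values: "finite {mu_p n p F | F. F \<subseteq> Pow {1..n} \<and> t_intersecting t F}"
proof -
  have "{mu_p n p F | F. F \<subseteq> Pow {1..n} \<and> t_intersecting t F} \<subseteq> mu_p n p ` Pow (Pow {1..n})" by blast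
  then show ?thesis by (rule finite_subset) simp
qed

lemma mu_p_le_w: "F \<subseteq> Pow {1..n} \<Longrightarrow> t_intersecting t F \<Longrightarrow> mu_p n p F \<le> w n t p"
  unfolding w_def by (rule Max_ge[OF finite_mu_p_values]) blast

lemma w_attained: obtains F where "F \<subseteq> Pow {1..n}" "t_intersecting t F" "mu_p n p F = w n t p"
proof -
  \<comment> \<open>The empty family is a competitor, so \<open>Max\<close> is taken over a nonempty
    set.\<close>
  have "mu_p n p {} \<in> {mu_p n p F | F. F \<subseteq> Pow {1..n} \<and> t_intersecting t F}"
    by (auto simp: t_intersecting_def)
  then have "w n t p \<in> {mu_p n p F | F. F \<subseteq> Pow {1..n} \<and> t_intersecting t F}"
    unfolding w_def by (intro Max_in finite_mu_p_values) blast
  then show ?thesis using that by auto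
qed

abbreviation cube :: "nat set \<Rightarrow> (nat \<Rightarrow> real) measure" where
  "cube I \<equiv> PiM I (\<lambda>_. circle)"

definition pullback :: "nat \<Rightarrow> real \<Rightarrow> nat set set \<Rightarrow> (nat \<Rightarrow> real) set" where
  "pullback n p A = {x \<in> space (cube {1..n}). {i\<in>{1..n}. x i < p} \<in> A}"

text \<open>The events \<open>x i < p\<close> are independent of probability \<open>p\<close>, so
  the set of coordinates below \<open>p\<close> has law \<mu>_p. Concretely, the pullback is a
  disjoint union of boxes with sides \<open>p\<close> and \<open>1 - p\<close>.\<close>

lemma emeasure_pullback:
  assumes p: "0 < p" "p < 1" and A: "A \<subseteq> Pow {1..n}"
  shows "pullback n p A \<in> sets (cube {1..n})" "emeasure (cube {1..n}) (pullback n p A) = ennreal (mu_p n p A)"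
proof -
  interpret C: product_sigma_finite "\<lambda>_. circle" by (rule product_sigma_finite_circle)
  define box where "box S = PiE {1..n} (\<lambda>i. if i \<in> S then {0..<p} else {p..<1})" for S
  have fin: "finite A" using A finite_subset by blast
  have mem: "x \<in> box S \<longleftrightarrow> x \<in> space (cube {1..n}) \<and> {i\<in>{1..n}. x i < p} = S" if "S \<subseteq> {1..n}" for x S
    using that p unfolding box_def space_PiM space_circle PiE_iff by (fastforce split: if_splits)
  have eq: "pullback n p A = (\<Union>S\<in>A. box S)"
  proof (rule set_eqI)
    fix x
    have "(\<exists>S\<in>A. x \<in> box S) \<longleftrightarrow> (\<exists>S\<in>A. x \<in> space (cube {1..n}) \<and> {i\<in>{1..n}. x i < p} = S)"
      using A mem by (intro bex_cong) auto
    then show "x \<in> pullback n p A \<longleftrightarrow> x \<in> (\<Union>S\<in>A. box S)" by (simp add: pullback_def)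
  qed
  have side: "(if i \<in> S then {0..<p} else {p..<1}) \<in> sets circle" for S and i :: nat
    using p by (auto simp: sets_circle)
  have box: "box S \<in> sets (cube {1..n})" for S unfolding box_def by (intro sets_PiM_I_finite side) simp
  show "pullback n p A \<in> sets (cube {1..n})" unfolding eq using fin box by auto
  have em: "emeasure (cube {1..n}) (box S) = ennreal (p ^ card S * (1 - p) ^ (n - card S))" if "S \<in> A" for S
  proof -
    have S: "S \<subseteq> {1..n}" using that A by blast
    have "emeasure (cube {1..n}) (box S) = (\<Prod>i\<in>{1..n}. emeasure circle (if i \<in> S then {0..<p} else {p..<1}))"
      unfolding box_def by (rule C.emeasure_PiM) (use side in auto)
    also have "\<dots> = (\<Prod>i\<in>{1..n}. ennreal (if i \<in> S then p else 1 - p))"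
      using p by (intro prod.cong refl) (auto simp: emeasure_circle)
    also have "\<dots> = ennreal (\<Prod>i\<in>{1..n}. if i \<in> S then p else 1 - p)"
      using p by (intro prod_ennreal) auto
    also have "(\<Prod>i\<in>{1..n}. if i \<in> S then p else 1 - p) = p ^ card S * (1 - p) ^ (n - card S)"
      using S by (simp add: prod.If_cases Int_absorb1 Diff_eq[symmetric] card_Diff_subset finite_subset)
    finally show ?thesis .
  qed
  have "emeasure (cube {1..n}) (pullback n p A) = (\<Sum>S\<in>A. emeasure (cube {1..n}) (box S))"
    unfolding eq
  proof (rule sum_emeasure[symmetric])
    show "disjoint_family_on box A"
      unfolding disjoint_family_on_def
    proof (intro ballI impI equals0I)
      fix S T x assume "S \<in> A" "T \<in> A" "S \<noteq> T" "x \<in> box S \<inter> box T"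
      moreover from this have "S \<subseteq> {1..n}" "T \<subseteq> {1..n}" using A by blast+
      ultimately show False using mem[of S x] mem[of T x] by simp
    qed
  qed (use box fin in auto)
  also have "\<dots> = ennreal (mu_p n p A)"
    unfolding mu_p_def using em p by (simp add: sum_ennreal)
  finally show "emeasure (cube {1..n}) (pullback n p A) = ennreal (mu_p n p A)" .
qed

lemma agreeing_pullback:
  assumes "p < 1/2" "t_intersecting t A"
  shows "agreeing_up_to n t p (pullback n p A)"
  unfolding agreeing_up_to_def
proof (intro ballI)
  fix x y assume xy: "x \<in> pullback n p A" "y \<in> pullback n p A"
  let ?I = "{i\<in>{1..n}. x i < p} \<inter> {i\<in>{1..n}. y i < p}"
  have "t \<le> card ?I" using xy assms by (auto simp: pullback_def t_intersecting_def)
  then obtain I where I: "I \<subseteq> ?I" "card I = t" by (meson obtain_subset_with_card_n)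
  have "circle_dist (x i) (y i) < p" if "i \<in> I" for i
  proof -
    have "x i \<in> {0..<1}" "y i \<in> {0..<1}" "x i < p" "y i < p"
      using that I xy by (auto simp: pullback_def space_PiM PiE_iff)
    then show ?thesis using assms by (auto simp: circle_dist_def)
  qed
  then show "\<exists>I\<subseteq>{1..n}. card I = t \<and> (\<forall>i\<in>I. circle_dist (x i) (y i) < p)" using I by blast
qed

text \<open>The end of the replacement process: agreement now depends only on which coordinates are
  below \<open>p\<close>, so the traces of the members form a \<open>t\<close>-intersecting family
  whose pullback contains \<open>F\<close>.\<close>

lemma emeasure_mixed_agreeing_all:
  assumes p: "0 < p" "p < 1" and F: "F \<in> sets (cube {1..n})" "mixed_agreeing n t p {1..n} F"
  shows "emeasure (cube {1..n}) F \<le> ennreal (w n t p)"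
proof -
  define A where "A = (\<lambda>x. {i\<in>{1..n}. x i < p}) ` F"
  have A: "A \<subseteq> Pow {1..n}" by (auto simp: A_def)
  have "{i\<in>{1..n}. x i < p} \<inter> {i\<in>{1..n}. y i < p} = {i\<in>{1..n}. mixed_close {1..n} p i (x i) (y i)}" for x y
    by (auto simp: mixed_close_def)
  then have t: "t_intersecting t A" using F by (auto simp: t_intersecting_def A_def mixed_agreeing_def)
  have "F \<subseteq> pullback n p A" using sets.sets_into_space[OF F(1)] by (auto simp: pullback_def A_def)
  then have "emeasure (cube {1..n}) F \<le> emeasure (cube {1..n}) (pullback n p A)"
    using emeasure_pullback(1)[OF p A] by (rule emeasure_mono)
  also have "\<dots> = ennreal (mu_p n p A)" by (rule emeasure_pullback(2)[OF p A])
  also have "\<dots> \<le> ennreal (w n t p)" by (intro ennreal_leI mu_p_le_w A t)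
  finally show ?thesis .
qed

section \<open>Replacing the relation at one coordinate by averaging over thresholds\<close>

text \<open>The factor after \<open>indicator {0..p} a\<close> is the measure of the new fibre at
  threshold \<open>a\<close> when the old one has measure \<open>v\<close>. Averaging over
  \<open>a\<close> therefore does not shrink fibres.\<close>

lemma average_threshold:
  fixes p v :: real
  assumes p: "0 < p" "p < 1/2" and v: "0 \<le> v" "v \<le> 1"
  shows "ennreal (p * v) \<le>
    (\<integral>\<^sup>+a. indicator {0..p} a * (ennreal p * indicator {p - a<..} v + ennreal (1 - p) * indicator {p + a<..} v) \<partial>lborel)"
proof -
  \<comment> \<open>\<open>m1\<close> and \<open>m2\<close> are the lengths of the sets of
    \<open>a\<close> in \<open>{0..p}\<close> with \<open>p - a < v\<close> and with
    \<open>p + a < v\<close>.\<close>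
  define m1 where "m1 = min v p"
  define m2 where "m2 = max 0 (min (v - p) p)"
  have m: "0 \<le> m1" "0 \<le> m2" using v p by (auto simp: m1_def m2_def)
  have "p * v \<le> p * m1 + (1 - p) * m2"
  proof (cases "v \<le> p")
    case True
    then show ?thesis using p by (simp add: m1_def m2_def)
  next
    case v1: False
    show ?thesis
    proof (cases "v \<le> 2 * p")
      case True
      \<comment> \<open>This product is exactly the surplus of the right-hand side. Beyond
        \<open>2 * p\<close> both lengths equal \<open>p\<close>, and the right-hand side is
        constantly \<open>p\<close>.\<close>
      have "0 \<le> (1 - 2 * p) * (v - p)" using v1 p by (intro mult_nonneg_nonneg) auto
      then show ?thesis using True v1 by (simp add: m1_def m2_def algebra_simps)
    next
      case False
      have "p * v \<le> p * 1" using p v by (intro mult_left_mono) auto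
      then show ?thesis using False v1 p by (simp add: m1_def m2_def algebra_simps)
    qed
  qed
  then have "ennreal (p * v) \<le> ennreal p * ennreal m1 + ennreal (1 - p) * ennreal m2"
    using p m by (simp add: ennreal_mult[symmetric] ennreal_plus[symmetric] ennreal_leI del: ennreal_plus)
  also have "\<dots> = (\<integral>\<^sup>+a. ennreal p * indicator {p - m1<..p} a + ennreal (1 - p) * indicator {0..<m2} a \<partial>lborel)"
    using m by (simp add: nn_integral_add nn_integral_cmult_indicator)
  also have "\<dots> \<le> (\<integral>\<^sup>+a. indicator {0..p} a * (ennreal p * indicator {p - a<..} v + ennreal (1 - p) * indicator {p + a<..} v) \<partial>lborel)"
  proof (rule nn_integral_mono)
    fix a :: real
    have ind: "indicator A a \<le> (indicator B a * indicator C v :: ennreal)"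
      if "a \<in> A \<longrightarrow> a \<in> B \<and> v \<in> C" for A B C :: "real set"
      using that by (cases "a \<in> A") simp_all
    have "indicator {p - m1<..p} a \<le> (indicator {0..p} a * indicator {p - a<..} v :: ennreal)"
      "indicator {0..<m2} a \<le> (indicator {0..p} a * indicator {p + a<..} v :: ennreal)"
      by (rule ind; auto simp: m1_def m2_def)+
    then have "ennreal p * indicator {p - m1<..p} a + ennreal (1 - p) * indicator {0..<m2} a
      \<le> ennreal p * (indicator {0..p} a * indicator {p - a<..} v) + ennreal (1 - p) * (indicator {0..p} a * indicator {p + a<..} v)"
      by (intro add_mono mult_left_mono) auto
    then show "ennreal p * indicator {p - m1<..p} a + ennreal (1 - p) * indicator {0..<m2} a
      \<le> indicator {0..p} a * (ennreal p * indicator {p - a<..} v + ennreal (1 - p) * indicator {p + a<..} v)"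
      by (simp add: distrib_left mult.left_commute)
  qed
  finally show ?thesis .
qed

text \<open>Any bound \<open>c\<close> for the relation replaced at \<open>k\<close> as well carries
  over to \<open>J\<close>: \<open>p\<close> times the measure of \<open>F\<close> is at most the
  integral over \<open>a\<close> in \<open>{0..p}\<close> of the measures of the new families, hence
  at most \<open>p * c\<close>.\<close>

lemma emeasure_mixed_agreeing_step:
  assumes p: "0 < p" "p < 1/2" and k: "k \<in> {1..n}" "k \<notin> J"
    and F: "F \<in> sets (cube {1..n})" "mixed_agreeing n t p J F"
    and bound: "\<And>G. G \<in> sets (cube {1..n}) \<Longrightarrow> mixed_agreeing n t p (insert k J) G \<Longrightarrow> emeasure (cube {1..n}) G \<le> c"
  shows "emeasure (cube {1..n}) F \<le> c"
proof -
  interpret C: product_sigma_finite "\<lambda>_. circle" by (rule product_sigma_finite_circle)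
  interpret circ: finite_measure circle by (rule finite_measure_circle)
  define I where "I = {1..n} - {k}"
  have I: "finite I" "k \<notin> I" "insert k I = {1..n}" "insert k {1..n} = {1..n}" using k by (auto simp: I_def)
  interpret CI: sigma_finite_measure "cube I" by (rule C.sigma_finite) (rule I)
  interpret CL: pair_sigma_finite lborel "cube I" ..
  \<comment> \<open>The update overwrites coordinate \<open>k\<close>, so \<open>fibre\<close> and
    \<open>v\<close> make sense both on the product over \<open>I\<close> and on the full cube, and
    do not depend on \<open>y k\<close>. Hence the two versions of the measurability facts.\<close>
  define fibre where "fibre y = {\<theta>\<in>{0..<1}. y(k := \<theta>) \<in> F}" for y
  define v where "v y = measure circle (fibre y)" for y
  have v_lborel: "v y = measure lborel (fibre y)" for y
    unfolding v_def by (rule measure_circle) (auto simp: fibre_def)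
  note [measurable] = F(1) and [simp del] = One_nat_def
  have upd[measurable]: "(\<lambda>\<theta>. y(k := \<theta>)) \<in> circle \<rightarrow>\<^sub>M cube {1..n}"
    if "y \<in> space (cube I) \<or> y \<in> space (cube {1..n})" for y
    using that
  proof
    assume y: "y \<in> space (cube I)"
    show ?thesis using measurable_compose[OF measurable_Pair1'[OF y] measurable_add_dim[of k I "\<lambda>_. circle"]] I by simp
  next
    assume y: "y \<in> space (cube {1..n})"
    show ?thesis using measurable_compose[OF measurable_Pair1'[OF y] measurable_add_dim[of k "{1..n}" "\<lambda>_. circle"]] I by simp
  qed
  have fibre: "fibre y \<in> sets circle" if "y \<in> space (cube I) \<or> y \<in> space (cube {1..n})" for y
    using measurable_sets[OF upd[OF that] F(1)] by (simp add: fibre_def vimage_def Int_def conj_commute)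
  have ev: "ennreal (v y) = (\<integral>\<^sup>+\<theta>. indicator F (y(k := \<theta>)) \<partial>circle)"
    if "y \<in> space (cube I) \<or> y \<in> space (cube {1..n})" for y
  proof -
    have "ennreal (v y) = (\<integral>\<^sup>+\<theta>. indicator (fibre y) \<theta> \<partial>circle)"
      using fibre[OF that] by (simp add: v_def circ.emeasure_eq_measure)
    also have "\<dots> = (\<integral>\<^sup>+\<theta>. indicator F (y(k := \<theta>)) \<partial>circle)"
      by (intro nn_integral_cong) (auto simp: indicator_def fibre_def)
    finally show ?thesis .
  qed
  have addI: "(\<lambda>(f, y). f(k := y)) \<in> cube I \<Otimes>\<^sub>M circle \<rightarrow>\<^sub>M cube {1..n}"
    using measurable_add_dim[of k I "\<lambda>_. circle"] I by simp
  have addn: "(\<lambda>(f, y). f(k := y)) \<in> cube {1..n} \<Otimes>\<^sub>M circle \<rightarrow>\<^sub>M cube {1..n}"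
    using measurable_add_dim[of k "{1..n}" "\<lambda>_. circle"] unfolding I(4) .
  have vmeas: "v \<in> borel_measurable (cube K)" if K: "K = I \<or> K = {1..n}" for K
  proof -
    have m: "(\<lambda>(f, y). f(k := y)) \<in> cube K \<Otimes>\<^sub>M circle \<rightarrow>\<^sub>M cube {1..n}" using K addI addn by auto
    have "(\<lambda>z. indicator F ((\<lambda>(f, y). f(k := y)) z) :: ennreal) \<in> borel_measurable (cube K \<Otimes>\<^sub>M circle)"
      by (rule measurable_compose[OF m borel_measurable_indicator[OF F(1)]])
    from sigma_finite_measure.borel_measurable_nn_integral_fst[OF C.sigma_finite_measures this]
    have "(\<lambda>y. \<integral>\<^sup>+\<theta>. indicator F (y(k := \<theta>)) \<partial>circle) \<in> borel_measurable (cube K)"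
      by simp
    then have "(\<lambda>y. enn2real (\<integral>\<^sup>+\<theta>. indicator F (y(k := \<theta>)) \<partial>circle)) \<in> borel_measurable (cube K)"
      by measurable
    moreover have "v y = enn2real (\<integral>\<^sup>+\<theta>. indicator F (y(k := \<theta>)) \<partial>circle)" if "y \<in> space (cube K)" for y
    proof -
      have "ennreal (v y) = (\<integral>\<^sup>+\<theta>. indicator F (y(k := \<theta>)) \<partial>circle)" using K that by (intro ev) auto
      then show ?thesis by (metis enn2real_ennreal v_def measure_nonneg)
    qed
    ultimately show ?thesis by (subst measurable_cong) auto
  qed
  note [measurable] = vmeas[OF disjI1[OF refl]] vmeas[OF disjI2[OF refl]]
  define G where "G a = {x\<in>space (cube {1..n}). x k < p \<and> p - a < v x \<or> p \<le> x k \<and> p + a < v x}" for a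
  have xk[measurable]: "(\<lambda>x. x k) \<in> borel_measurable (cube {1..n})"
    using measurable_component_singleton[OF k(1), of "\<lambda>_. circle"] by measurable
  have G[measurable]: "G a \<in> sets (cube {1..n})" for a
    unfolding G_def by measurable
  have G_agree: "mixed_agreeing n t p (insert k J) (G a)" if a: "a \<in> {0..p}" for a
    unfolding mixed_agreeing_def
  proof (intro ballI)
    fix x y assume xy: "x \<in> G a" "y \<in> G a"
    \<comment> \<open>Agreements away from \<open>k\<close>, unaffected by the change of relation or
      of the values at \<open>k\<close>. \<open>card_eq\<close> is kept general to serve both
      \<open>x\<close>, \<open>y\<close> under the new relation and their updates under the old
      one.\<close>
    define cnt where "cnt = card {i\<in>I. mixed_close J p i (x i) (y i)}"
    have card_eq: "card {i\<in>{1..n}. mixed_close K p i (f i) (g i)} = cnt + (if mixed_close K p k (f k) (g k) then 1 else 0)"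
      if eq: "\<And>i. i \<in> I \<Longrightarrow> f i = x i \<and> g i = y i \<and> (i \<in> K \<longleftrightarrow> i \<in> J)" for K f g
    proof -
      have "mixed_close K p i (f i) (g i) \<longleftrightarrow> mixed_close J p i (x i) (y i)" if "i \<in> I" for i
        using eq[OF that] by (simp add: mixed_close_def)
      then have "{i\<in>I. mixed_close K p i (f i) (g i)} = {i\<in>I. mixed_close J p i (x i) (y i)}" by blast
      moreover have "{i\<in>insert k I. mixed_close K p i (f i) (g i)} =
        {i\<in>I. mixed_close K p i (f i) (g i)} \<union> (if mixed_close K p k (f k) (g k) then {k} else {})"
        by auto
      ultimately have "{i\<in>{1..n}. mixed_close K p i (f i) (g i)} =
        {i\<in>I. mixed_close J p i (x i) (y i)} \<union> (if mixed_close K p k (f k) (g k) then {k} else {})"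
        by (simp only: I(3))
      then show ?thesis using I(1,2) by (simp add: cnt_def)
    qed
    have sp: "x \<in> space (cube {1..n})" "y \<in> space (cube {1..n})" using xy by (auto simp: G_def)
    \<comment> \<open>Here \<open>a \<le> p\<close> matters: both thresholds are nonnegative, so
      membership in \<open>G a\<close> forces fibres of positive measure.\<close>
    have pos: "0 < v x" "0 < v y" using xy a by (auto simp: G_def)
    then have ne: "fibre x \<noteq> {}" "fibre y \<noteq> {}" by (auto simp: v_def)
    have target: "card {i\<in>{1..n}. mixed_close (insert k J) p i (x i) (y i)} = cnt + (if x k < p \<and> y k < p then 1 else 0)"
      by (subst card_eq) (auto simp: mixed_close_def I(2))
    have fib: "t \<le> cnt + (if circle_dist \<theta> \<theta>' < p then 1 else 0)" if "\<theta> \<in> fibre x" "\<theta>' \<in> fibre y" for \<theta> \<theta>'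
    proof -
      have "t \<le> card {i\<in>{1..n}. mixed_close J p i ((x(k := \<theta>)) i) ((y(k := \<theta>')) i)}"
        using that F(2) unfolding mixed_agreeing_def fibre_def by blast
      also have "\<dots> = cnt + (if mixed_close J p k ((x(k := \<theta>)) k) ((y(k := \<theta>')) k) then 1 else 0)"
        by (rule card_eq) (use I(2) in auto)
      finally show ?thesis using k by (simp add: mixed_close_def)
    qed
    show "t \<le> card {i\<in>{1..n}. mixed_close (insert k J) p i (x i) (y i)}"
    proof (cases "t \<le> cnt")
      case True
      then show ?thesis unfolding target by simp
    next
      case False
      then have close: "circle_dist \<theta> \<theta>' < p" if "\<theta> \<in> fibre x" "\<theta>' \<in> fibre y" for \<theta> \<theta>'
        using fib[OF that] by (auto split: if_splits)
      have "measure lborel (fibre x) + measure lborel (fibre y) \<le> 2 * p"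
        using fibre[OF disjI2[OF sp(1)]] fibre[OF disjI2[OF sp(2)]] ne p close
        unfolding sets_circle by (intro measure_circle_close_le) blast+
      then have "v x + v y \<le> 2 * p"
        by (simp only: v_lborel)
      \<comment> \<open>If one value were at least \<open>p\<close>, its fibre would exceed
        \<open>p + a\<close> while the other exceeds \<open>p - a\<close>, giving a sum above
        \<open>2 * p\<close>. So \<open>k\<close> supplies the one agreement still missing.\<close>
      then have "x k < p \<and> y k < p" using xy a by (auto simp: G_def)
      moreover obtain \<theta> \<theta>' where "\<theta> \<in> fibre x" "\<theta>' \<in> fibre y" using ne by blast
      then have "t \<le> cnt + 1" using fib[of \<theta> \<theta>'] by (auto split: if_splits)
      ultimately show ?thesis unfolding target by simp
    qed
  qed
  \<comment> \<open>The measure of the fibre of \<open>G a\<close> where the old fibre has measure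
    \<open>s\<close>: the arc of length \<open>p\<close> above the first threshold, and its
    complement added above the second.\<close>
  let ?h = "\<lambda>a s. ennreal p * indicator {p - a<..} s + ennreal (1 - p) * indicator {p + a<..} s"
  have G_meas: "emeasure (cube {1..n}) (G a) = (\<integral>\<^sup>+y. ?h a (v y) \<partial>cube I)" for a
  proof -
    have "emeasure (cube {1..n}) (G a) = (\<integral>\<^sup>+x. indicator (G a) x \<partial>cube {1..n})" by simp
    also have "\<dots> = (\<integral>\<^sup>+y. \<integral>\<^sup>+\<theta>. indicator (G a) (y(k := \<theta>)) \<partial>circle \<partial>cube I)"
      by (rule C.product_nn_integral_insert[OF I(1,2), unfolded I(3), OF borel_measurable_indicator[OF G]])
    also have "\<dots> = (\<integral>\<^sup>+y. ?h a (v y) \<partial>cube I)"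
    proof (rule nn_integral_cong)
      fix y assume y: "y \<in> space (cube I)"
      have "(\<integral>\<^sup>+\<theta>. indicator (G a) (y(k := \<theta>)) \<partial>circle) =
        (\<integral>\<^sup>+\<theta>. indicator {p - a<..} (v y) * indicator {0..<p} \<theta> + indicator {p + a<..} (v y) * indicator {p..<1} \<theta> \<partial>circle)"
      proof (rule nn_integral_cong)
        fix \<theta> assume th: "\<theta> \<in> space circle"
        have "y(k := \<theta>) \<in> space (cube {1..n})" using measurable_space[OF upd th] y by auto
        moreover have "v (y(k := \<theta>)) = v y" by (simp add: v_def fibre_def)
        ultimately show "indicator (G a) (y(k := \<theta>)) =
          (indicator {p - a<..} (v y) * indicator {0..<p} \<theta> + indicator {p + a<..} (v y) * indicator {p..<1} \<theta> :: ennreal)"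
          using th by (auto simp: G_def indicator_def)
      qed
      also have "\<dots> = indicator {p - a<..} (v y) * emeasure circle {0..<p} + indicator {p + a<..} (v y) * emeasure circle {p..<1}"
      proof -
        have "{0..<p} \<in> sets circle" "{p..<1} \<in> sets circle" using p by (auto simp: sets_circle)
        then show ?thesis by (simp add: nn_integral_add nn_integral_cmult_indicator)
      qed
      also have "\<dots> = ?h a (v y)" using p by (simp add: emeasure_circle mult.commute)
      finally show "(\<integral>\<^sup>+\<theta>. indicator (G a) (y(k := \<theta>)) \<partial>circle) = ?h a (v y)" .
    qed
    finally show ?thesis .
  qed
  have v1: "0 \<le> v y" "v y \<le> 1" for y
  proof -
    have "v y \<le> measure circle (space circle)" unfolding v_def by (rule circ.bounded_measure)
    then show "v y \<le> 1" by (simp add: measure_circle)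
  qed (simp add: v_def)
  have "emeasure (cube {1..n}) F = (\<integral>\<^sup>+x. indicator F x \<partial>cube {1..n})" by simp
  also have "\<dots> = (\<integral>\<^sup>+y. \<integral>\<^sup>+\<theta>. indicator F (y(k := \<theta>)) \<partial>circle \<partial>cube I)"
    by (rule C.product_nn_integral_insert[OF I(1,2), unfolded I(3), OF borel_measurable_indicator[OF F(1)]])
  also have "\<dots> = (\<integral>\<^sup>+y. ennreal (v y) \<partial>cube I)"
    by (intro nn_integral_cong) (simp add: ev)
  \<comment> \<open>The factor \<open>p\<close>, the length of \<open>{0..p}\<close>, turns the
    average over thresholds into an integral; it is cancelled at the end.\<close>
  finally have "ennreal p * emeasure (cube {1..n}) F = (\<integral>\<^sup>+y. ennreal (p * v y) \<partial>cube I)"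
    using p v1 by (simp add: nn_integral_cmult ennreal_mult)
  also have "\<dots> \<le> (\<integral>\<^sup>+y. \<integral>\<^sup>+a. indicator {0..p} a * ?h a (v y) \<partial>lborel \<partial>cube I)"
    by (intro nn_integral_mono average_threshold p v1)
  also have "\<dots> = (\<integral>\<^sup>+a. \<integral>\<^sup>+y. indicator {0..p} a * ?h a (v y) \<partial>cube I \<partial>lborel)"
    by (rule CL.Fubini') (simp add: indicator_def, measurable)
  also have "\<dots> = (\<integral>\<^sup>+a. indicator {0..p} a * emeasure (cube {1..n}) (G a) \<partial>lborel)"
    by (simp add: G_meas nn_integral_cmult)
  also have "\<dots> \<le> (\<integral>\<^sup>+a. c * indicator {0..p} a \<partial>lborel)"
    using bound[OF G G_agree] by (intro nn_integral_mono) (auto simp: indicator_def)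
  also have "\<dots> = ennreal p * c" using p by (simp add: nn_integral_cmult_indicator mult.commute)
  finally show ?thesis using p by (simp add: ennreal_mult_le_mult_iff)
qed

section \<open>Induction over the coordinates and passage to Lebesgue measurable families\<close>

lemma emeasure_mixed_agreeing_le_w:
  assumes p: "0 < p" "p < 1/2" and "J \<subseteq> {1..n}"
    and F: "F \<in> sets (cube {1..n})" "mixed_agreeing n t p J F"
  shows "emeasure (cube {1..n}) F \<le> ennreal (w n t p)"
proof -
  have "finite ({1..n} - J)" by simp
  then show ?thesis using assms(3-)
  \<comment> \<open>The induction is on the set of coordinates not yet replaced.\<close>
  proof (induction "{1..n} - J" arbitrary: J F rule: finite_psubset_induct)
    case psubset
    show ?case
    proof (cases "J = {1..n}")
      case True
      then show ?thesis using psubset p by (intro emeasure_mixed_agreeing_all) auto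
    next
      case False
      then obtain k where k: "k \<in> {1..n}" "k \<notin> J" using psubset by blast
      show ?thesis
        using p k psubset(4,5)
      proof (rule emeasure_mixed_agreeing_step)
        fix G assume "G \<in> sets (cube {1..n})" "mixed_agreeing n t p (insert k J) G"
        then show "emeasure (cube {1..n}) G \<le> ennreal (w n t p)"
          using k psubset(3) by (intro psubset(2)[of "insert k J"]) auto
      qed
    qed
  qed
qed

text \<open>The first two conjuncts state that the maximum is attained, which gives the
  \<open>GREATEST\<close> in \<open>w_torus\<close> its meaning.\<close>

theorem theorem5p12:
  fixes n t :: nat and p :: real
  assumes "n \<ge> 1" and "t \<ge> 1" and "0 < p" and "p < 1 / 2"
  shows "(\<exists>F\<in>sets (torus n). agreeing_up_to n t p F \<and> measure (torus n) F = w n t p) \<and>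
         (\<forall>F\<in>sets (torus n). agreeing_up_to n t p F \<longrightarrow> measure (torus n) F \<le> w n t p) \<and>
         w_torus n t p = w n t p"
proof -
  obtain A where A: "A \<subseteq> Pow {1..n}" "t_intersecting t A" "mu_p n p A = w n t p" by (rule w_attained)
  \<comment> \<open>Needed because \<open>ennreal\<close> sends negative reals to
    \<open>0\<close>.\<close>
  have w0: "0 \<le> w n t p" unfolding A(3)[symmetric] mu_p_def using assms by (intro sum_nonneg) simp
  have ex: "\<exists>F\<in>sets (torus n). agreeing_up_to n t p F \<and> measure (torus n) F = w n t p"
  proof (intro bexI conjI)
    have p1: "p < 1" using assms by simp
    have pullback: "pullback n p A \<in> sets (cube {1..n})" using emeasure_pullback(1)[OF assms(3) p1 A(1)] .
    then show "pullback n p A \<in> sets (torus n)" by (simp add: torus_def sets_completionI_sets)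
    show "agreeing_up_to n t p (pullback n p A)" using assms A by (intro agreeing_pullback)
    show "measure (torus n) (pullback n p A) = w n t p"
      using pullback emeasure_pullback(2)[OF assms(3) p1 A(1)] A(3) w0 by (simp add: torus_def measure_def)
  qed
  have le: "measure (torus n) F \<le> w n t p" if F: "F \<in> sets (torus n)" "agreeing_up_to n t p F" for F
  proof -
    \<comment> \<open>The upper bound is proved for the uncompleted product. The main part is
      measurable there, has the same measure as \<open>F\<close>, and inherits agreement as a subset
      of \<open>F\<close>.\<close>
    let ?S = "main_part (cube {1..n}) F"
    have F': "F \<in> sets (completion (cube {1..n}))" using F(1) by (simp add: torus_def)
    have "?S \<subseteq> F" using main_part_null_part_Un[OF F'] by blast
    then have "agreeing_up_to n t p ?S" using F(2) unfolding agreeing_up_to_def by blast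
    then have "emeasure (cube {1..n}) ?S \<le> ennreal (w n t p)"
      using assms F' by (intro emeasure_mixed_agreeing_le_w[where J = "{}"] agreeing_imp_mixed) auto
    then have "emeasure (torus n) F \<le> ennreal (w n t p)" using F' by (simp add: torus_def)
    then show ?thesis using w0 by (simp add: measure_def enn2real_leI)
  qed
  have "w_torus n t p = w n t p"
    unfolding w_torus_def by (rule Greatest_equality) (use ex le in \<open>auto intro: sym\<close>)
  then show ?thesis using ex le by blast
qed

end
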